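(* Let $k\in\mathbb{R}$, let $w=(w_m)_{m\in\mathbb{Z}}$ be a sequence of real weights with $w_m>0$ for every $m\in\mathbb{Z}$, and let $s,t$ be real numbers with $s>t\ge 1$. Then every linear bounded operator $T:h^{k,s}_{\mathbb{C},w}\to h^{k,t}_{\mathbb{C},w}$ is compact.
   Context: For $s\in[1,+\infty)$, $k\in\mathbb{R}$ and a sequence of weights $w=(w_m)_{m\in\mathbb{Z}}$ with $w_m>0$ for every $m$, $h^{k,s}_{\mathbb{C},w}$ denotes the Banach space of all complex sequences $p=(p_m)_{m\in\mathbb{Z}}$ with $$\|p\|_{k,s,w}:=\Big(\sum_{m\in\mathbb{Z}}w_m(1+|m|^s)^k|p_m|^s\Big)^{1/s}<+\infty,$$ with the usual componentwise algebraic operations and this norm. Note that the summability exponent also appears in the factor $(1+|m|^s)^k$, so the norm of $h^{k,t}_{\mathbb{C},w}$ is $\big(\sum_{m\in\mathbb{Z}}w_m(1+|m|^t)^k|p_m|^t\big)^{1/t}$. *)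

theory Defs
  imports "HOL-Analysis.Analysis"
begin

text \<open>
  The spaces depend on the real parameters \<open>k\<close>, \<open>s\<close> and on the weight, so they are represented
  as carrier sets of two-sided sequences together with a norm function. In the summand \<open>s\<close> is
  always at least 1, so \<open>0 powr s = 0\<close> agrees with the usual convention.
\<close>

definition wseq_term :: "real \<Rightarrow> real \<Rightarrow> (int \<Rightarrow> real) \<Rightarrow> (int \<Rightarrow> complex) \<Rightarrow> int \<Rightarrow> real" where
  "wseq_term k s w p m = w m * (1 + \<bar>real_of_int m\<bar> powr s) powr k * cmod (p m) powr s"

definition wseq_space :: "real \<Rightarrow> real \<Rightarrow> (int \<Rightarrow> real) \<Rightarrow> (int \<Rightarrow> complex) set" where
  "wseq_space k s w = {p. wseq_term k s w p summable_on UNIV}"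

definition wseq_norm :: "real \<Rightarrow> real \<Rightarrow> (int \<Rightarrow> real) \<Rightarrow> (int \<Rightarrow> complex) \<Rightarrow> real" where
  "wseq_norm k s w p = (\<Sum>\<^sub>\<infinity>m. wseq_term k s w p m) powr (1 / s)"

text \<open>
  Operators between sequence spaces \<open>X\<close>, \<open>Y\<close> (carrier sets) with norms \<open>N\<close>, \<open>M\<close>; the vector
  operations are componentwise and the scalars complex. Values of \<open>T\<close> off \<open>X\<close> are irrelevant.
\<close>

definition linear_operator ::
  "(int \<Rightarrow> complex) set \<Rightarrow> (int \<Rightarrow> complex) set \<Rightarrow> ((int \<Rightarrow> complex) \<Rightarrow> (int \<Rightarrow> complex)) \<Rightarrow> bool" where
  "linear_operator X Y T \<longleftrightarrow>
     T \<in> X \<rightarrow> Y \<and>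
     (\<forall>p\<in>X. \<forall>q\<in>X. T (\<lambda>m. p m + q m) = (\<lambda>m. T p m + T q m)) \<and>
     (\<forall>c. \<forall>p\<in>X. T (\<lambda>m. c * p m) = (\<lambda>m. c * T p m))"

definition bounded_linear_operator ::
  "(int \<Rightarrow> complex) set \<Rightarrow> ((int \<Rightarrow> complex) \<Rightarrow> real) \<Rightarrow>
   (int \<Rightarrow> complex) set \<Rightarrow> ((int \<Rightarrow> complex) \<Rightarrow> real) \<Rightarrow>
   ((int \<Rightarrow> complex) \<Rightarrow> (int \<Rightarrow> complex)) \<Rightarrow> bool" where
  "bounded_linear_operator X N Y M T \<longleftrightarrow>
     linear_operator X Y T \<and> (\<exists>C. \<forall>p\<in>X. M (T p) \<le> C * N p)"

definition norm_topology ::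
  "(int \<Rightarrow> complex) set \<Rightarrow> ((int \<Rightarrow> complex) \<Rightarrow> real) \<Rightarrow> (int \<Rightarrow> complex) topology" where
  "norm_topology Y M = Metric_space.mtopology Y (\<lambda>p q. M (\<lambda>m. p m - q m))"

text \<open>Compactness: norm-bounded sets are mapped to relatively compact sets.\<close>

definition compact_operator ::
  "(int \<Rightarrow> complex) set \<Rightarrow> ((int \<Rightarrow> complex) \<Rightarrow> real) \<Rightarrow>
   (int \<Rightarrow> complex) set \<Rightarrow> ((int \<Rightarrow> complex) \<Rightarrow> real) \<Rightarrow>
   ((int \<Rightarrow> complex) \<Rightarrow> (int \<Rightarrow> complex)) \<Rightarrow> bool" where
  "compact_operator X N Y M T \<longleftrightarrow>
     linear_operator X Y T \<and>
     (\<forall>B. B \<subseteq> X \<and> (\<exists>R. \<forall>p\<in>B. N p \<le> R) \<longrightarrow>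
          compactin (norm_topology Y M) (norm_topology Y M closure_of (T ` B)))"

end

theory Submission
  imports Defs
begin

text \<open>
  This is Pitt's theorem for weighted spaces: only the exponents \<open>s > t\<close> matter, the two weights
  being arbitrary. The point is that the norm of \<open>T\<close> on the vectors vanishing on a finite set \<open>F\<close>
  tends to \<open>0\<close> as \<open>F\<close> grows. Otherwise there are \<open>\<epsilon> > 0\<close> and unit vectors \<open>y\<close> supported arbitrarily
  far out with \<open>\<parallel>T y\<parallel> > \<epsilon>\<close>. Each coordinate of \<open>T y\<close> is small for such \<open>y\<close> (a bounded functional on
  the domain is small far out, because \<open>s > 1\<close>), so one can add up \<open>n\<close> of them with disjoint supports
  and almost disjoint images. The sum has norm at most \<open>n powr (1 / s)\<close> while its image has norm at
  least \<open>(\<epsilon> / 2) * n powr (1 / t)\<close>, which is impossible for large \<open>n\<close>. Hence \<open>T\<close> is a norm limit of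
  finite-rank operators, and it maps bounded sets to totally bounded ones in a complete space.
\<close>

section \<open>Convexity of powers on the nonnegative half-line\<close>

lemma powr_convex_combination:
  fixes a b x y s :: real
  assumes "s \<ge> 1" "a \<ge> 0" "b \<ge> 0" "a + b = 1" "x \<ge> 0" "y \<ge> 0"
  shows "(a * x + b * y) powr s \<le> a * x powr s + b * y powr s"
proof -
  \<comment> \<open>This settles the cases \<open>x = 0\<close> and \<open>y = 0\<close>: only one
    scaled point remains, and a coefficient in [0, 1] decreases when raised to a power at least 1.
    Convexity is then invoked only at positive points.\<close>
  have scale: "(c * z) powr s \<le> c * z powr s" if "0 \<le> c" "c \<le> 1" "z \<ge> 0" for c z :: real
  proof -
    have "c powr s \<le> c"
      using powr_mono'[of 1 s c] that assms(1) by (cases "c = 0") auto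
    then show ?thesis
      using that by (simp add: powr_mult mult_right_mono)
  qed
  show ?thesis
  proof (cases "x > 0 \<and> y > 0")
    case True
    then show ?thesis
      using convex_onD[OF powr_convex[OF assms(1)], of b x y] assms
      by (simp add: eq_diff_eq[THEN iffD2, OF assms(4)])
  next
    case False
    then have "x = 0 \<or> y = 0" using assms by auto
    then show ?thesis
      using scale[of a x] scale[of b y] assms by auto
  qed
qed

section \<open>Weighted sequence spaces with one abstract positive weight\<close>

definition cut :: "'a set \<Rightarrow> ('a \<Rightarrow> complex) \<Rightarrow> 'a \<Rightarrow> complex" where
  "cut A p = (\<lambda>m. if m \<in> A then p m else 0)"

lemma cut_apply [simp]: "cut A p m = (if m \<in> A then p m else 0)"
  by (simp add: cut_def)

text \<open>For fixed exponent and \<open>k\<close>, the product of \<open>w m\<close> with the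
  polynomial factor is just one positive weight. Nothing below depends on its shape or on the order
  of the indices, so both are abstract.\<close>

locale weighted_lp =
  fixes v :: "'a \<Rightarrow> real" and s :: real
  assumes v_pos: "v m > 0" and s_ge_1: "s \<ge> 1"
begin

definition lp_term :: "('a \<Rightarrow> complex) \<Rightarrow> 'a \<Rightarrow> real" where
  "lp_term p m = v m * cmod (p m) powr s"

definition lp_space :: "('a \<Rightarrow> complex) set" where
  "lp_space = {p. lp_term p summable_on UNIV}"

text \<open>The s-th power of the norm gets its own name because it, and not the norm, is additive
  over disjoint supports.\<close>

definition lp_sum :: "('a \<Rightarrow> complex) \<Rightarrow> real" where
  "lp_sum p = (\<Sum>\<^sub>\<infinity>m. lp_term p m)"

definition lp_norm :: "('a \<Rightarrow> complex) \<Rightarrow> real" where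
  "lp_norm p = lp_sum p powr (1 / s)"

lemma s_pos: "s > 0"
  using s_ge_1 by simp

lemma lp_term_nonneg: "lp_term p m \<ge> 0"
  using v_pos[of m] by (simp add: lp_term_def)

lemma lp_sum_nonneg: "lp_sum p \<ge> 0"
  by (simp add: lp_sum_def infsum_nonneg lp_term_nonneg)

lemma lp_norm_nonneg [simp]: "lp_norm p \<ge> 0"
  by (simp add: lp_norm_def)

lemma lp_norm_powr: "lp_norm p powr s = lp_sum p"
  using s_pos lp_sum_nonneg by (simp add: lp_norm_def powr_powr)

lemma lp_norm_le_iff:
  assumes "c \<ge> 0"
  shows "lp_norm p \<le> c \<longleftrightarrow> lp_sum p \<le> c powr s"
  by (metis assms lp_norm_nonneg lp_norm_powr powr_less_mono2 powr_mono2 s_pos not_le order_less_imp_le)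

lemma sum_lp_term_le:
  assumes "p \<in> lp_space" "finite F"
  shows "sum (lp_term p) F \<le> lp_sum p"
  unfolding lp_sum_def
  using assms by (intro finite_sum_le_infsum) (auto simp: lp_space_def lp_term_nonneg)

text \<open>The terms are nonnegative, so finite partial sums decide both summability and the size
  of the sum. Majorants, sums and pointwise limits are all handled through this one
  criterion.\<close>

lemma lp_spaceI:
  assumes "\<And>F. finite F \<Longrightarrow> sum (lp_term p) F \<le> c"
  shows "p \<in> lp_space" and "lp_sum p \<le> c"
proof -
  show "p \<in> lp_space"
    unfolding lp_space_def mem_Collect_eq
    by (rule nonneg_bdd_above_summable_on) (auto simp: lp_term_nonneg assms intro!: bdd_aboveI[of _ c])
  then show "lp_sum p \<le> c"
    unfolding lp_sum_def
    by (intro infsum_le_finite_sums) (auto simp: lp_space_def assms)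
qed

lemma lp_spaceI_mono:
  assumes "q \<in> lp_space" "\<And>m. cmod (p m) \<le> cmod (q m)"
  shows "p \<in> lp_space" and "lp_sum p \<le> lp_sum q" and "lp_norm p \<le> lp_norm q"
proof -
  have "sum (lp_term p) F \<le> lp_sum q" if "finite F" for F
  proof -
    have "lp_term p m \<le> lp_term q m" for m
      using assms(2)[of m] v_pos[of m] s_pos by (auto simp: lp_term_def intro!: mult_left_mono powr_mono2)
    then show ?thesis
      by (intro order_trans[OF sum_mono sum_lp_term_le[OF assms(1) that]])
  qed
  then show "p \<in> lp_space" "lp_sum p \<le> lp_sum q"
    using lp_spaceI by blast+
  then show "lp_norm p \<le> lp_norm q"
    using s_pos lp_sum_nonneg by (simp add: lp_norm_def powr_mono2)
qed

lemma lp_term_scale: "lp_term (\<lambda>m. c * p m) = (\<lambda>m. cmod c powr s * lp_term p m)"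
  by (auto simp: lp_term_def norm_mult powr_mult)

lemma lp_space_scale: "p \<in> lp_space \<Longrightarrow> (\<lambda>m. c * p m) \<in> lp_space"
  by (simp add: lp_space_def lp_term_scale summable_on_cmult_right)

lemma lp_sum_scale: "lp_sum (\<lambda>m. c * p m) = cmod c powr s * lp_sum p"
  by (simp add: lp_sum_def lp_term_scale infsum_cmult_right')

lemma lp_norm_scale: "lp_norm (\<lambda>m. c * p m) = cmod c * lp_norm p"
  using s_pos lp_sum_nonneg by (simp add: lp_norm_def lp_sum_scale powr_mult powr_powr)

lemma lp_zero: "(\<lambda>_. 0) \<in> lp_space" "lp_norm (\<lambda>_. 0) = 0" "lp_sum (\<lambda>_. 0) = 0"
  by (simp_all add: lp_space_def lp_norm_def lp_sum_def lp_term_def[abs_def])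

text \<open>A single summand is at most the whole sum. The resulting continuity of the coordinates
  yields definiteness of the norm, pointwise limits of Cauchy sequences, and boundedness of the
  coordinate functionals of an operator.\<close>

lemma norm_coord_le:
  assumes "p \<in> lp_space"
  shows "v m powr (1 / s) * cmod (p m) \<le> lp_norm p"
proof -
  have "(v m powr (1 / s) * cmod (p m)) powr s = lp_term p m"
    using s_pos v_pos[of m] by (simp add: lp_term_def powr_mult powr_powr)
  also have "\<dots> \<le> lp_norm p powr s"
    using sum_lp_term_le[OF assms, of "{m}"] by (simp add: lp_norm_powr)
  finally show ?thesis
    by (meson lp_norm_nonneg not_le powr_less_mono2 s_pos)
qed

lemma lp_norm_eq_0: "p \<in> lp_space \<Longrightarrow> lp_norm p = 0 \<longleftrightarrow> p = (\<lambda>_. 0)"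
proof
  assume p: "p \<in> lp_space" "lp_norm p = 0"
  show "p = (\<lambda>_. 0)"
  proof
    fix m
    show "p m = 0"
      using norm_coord_le[OF p(1), of m] p(2) v_pos[of m]
      by (simp add: mult_le_0_iff)
  qed
qed (simp add: lp_zero)

text \<open>Minkowski's inequality, from the convexity of the unit ball.\<close>

lemma lp_add:
  assumes p: "p \<in> lp_space" and q: "q \<in> lp_space"
  shows lp_space_add: "(\<lambda>m. p m + q m) \<in> lp_space"
    and lp_norm_triangle: "lp_norm (\<lambda>m. p m + q m) \<le> lp_norm p + lp_norm q"
proof -
  have "(\<lambda>m. p m + q m) \<in> lp_space \<and> lp_norm (\<lambda>m. p m + q m) \<le> lp_norm p + lp_norm q"
  proof (cases "lp_norm p = 0 \<or> lp_norm q = 0")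
    case True
    then show ?thesis
      using p q lp_norm_eq_0[OF p] lp_norm_eq_0[OF q] by (auto simp: lp_zero)
  next
    case False
    define a where "a = lp_norm p"
    define b where "b = lp_norm q"
    have ab: "a > 0" "b > 0"
      using False by (auto simp: a_def b_def order.strict_iff_order)
    \<comment> \<open>Convexity is used at the normalised moduli \<open>cmod (p m) / a\<close> and
      \<open>cmod (q m) / b\<close>, with coefficients \<open>a / (a + b)\<close> and
      \<open>b / (a + b)\<close>. After summation each normalised sum is at most 1, so the bracket
      is at most 1.\<close>
    have term_le: "lp_term (\<lambda>m. p m + q m) m \<le>
        (a + b) powr s * (a / (a + b) * (lp_term p m / a powr s) + b / (a + b) * (lp_term q m / b powr s))" for m
    proof -
      have "cmod (p m + q m) powr s \<le> (cmod (p m) + cmod (q m)) powr s"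
        using s_pos by (intro powr_mono2 norm_triangle_ineq) auto
      also have "cmod (p m) + cmod (q m) =
          (a + b) * (a / (a + b) * (cmod (p m) / a) + b / (a + b) * (cmod (q m) / b))"
      proof -
        have "(a + b) * (a / (a + b) * x + b / (a + b) * y) = a * x + b * y" for x y
          using ab by (simp add: distrib_left)
        from this[of "cmod (p m) / a" "cmod (q m) / b"] show ?thesis
          using ab by simp
      qed
      also have "\<dots> powr s \<le> (a + b) powr s *
          (a / (a + b) * (cmod (p m) / a) powr s + b / (a + b) * (cmod (q m) / b) powr s)"
        using ab s_ge_1 
        by (subst powr_mult, intro mult_left_mono powr_convex_combination)
           (auto simp: add_divide_distrib[symmetric])
      finally have "v m * cmod (p m + q m) powr s \<le> v m * \<dots>"
        using v_pos[of m] by (intro mult_left_mono) auto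
      then show ?thesis
        using ab by (simp add: lp_term_def powr_divide algebra_simps)
    qed
    have le: "sum (lp_term (\<lambda>m. p m + q m)) F \<le> (a + b) powr s" if "finite F" for F
    proof -
      have "sum (lp_term (\<lambda>m. p m + q m)) F \<le> (a + b) powr s *
          (a / (a + b) * (sum (lp_term p) F / a powr s) + b / (a + b) * (sum (lp_term q) F / b powr s))"
        by (rule order_trans[OF sum_mono[OF term_le]])
           (simp add: sum_distrib_left[symmetric] sum.distrib sum_divide_distrib[symmetric])
      also have "\<dots> \<le> (a + b) powr s * (a / (a + b) * 1 + b / (a + b) * 1)"
        using ab sum_lp_term_le[OF p that] sum_lp_term_le[OF q that]
        unfolding lp_norm_powr[symmetric] a_def[symmetric] b_def[symmetric]
        by (intro mult_left_mono add_mono) auto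
      also have "\<dots> = (a + b) powr s"
        using ab by (simp add: add_divide_distrib[symmetric])
      finally show ?thesis .
    qed
    then show ?thesis
      using lp_spaceI[OF le] ab by (simp add: lp_norm_le_iff a_def b_def)
  qed
  then show "(\<lambda>m. p m + q m) \<in> lp_space"
    and "lp_norm (\<lambda>m. p m + q m) \<le> lp_norm p + lp_norm q" by auto
qed

lemma lp_space_diff: "p \<in> lp_space \<Longrightarrow> q \<in> lp_space \<Longrightarrow> (\<lambda>m. p m - q m) \<in> lp_space"
  using lp_space_add[OF _ lp_space_scale[of q "-1"]] by simp

lemma lp_norm_minus_commute: "lp_norm (\<lambda>m. p m - q m) = lp_norm (\<lambda>m. q m - p m)"
  by (simp add: lp_norm_def lp_sum_def lp_term_def norm_minus_commute)

lemma lp_norm_triangle_sub: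
  assumes "p \<in> lp_space" "q \<in> lp_space"
  shows "lp_norm p \<le> lp_norm q + lp_norm (\<lambda>m. p m - q m)"
  using lp_norm_triangle[OF assms(2) lp_space_diff[OF assms]] by simp

lemma lp_norm_triangle_diff:
  assumes "p \<in> lp_space" "q \<in> lp_space" "r \<in> lp_space"
  shows "lp_norm (\<lambda>m. p m - r m) \<le> lp_norm (\<lambda>m. p m - q m) + lp_norm (\<lambda>m. q m - r m)"
  using lp_norm_triangle[OF lp_space_diff[OF assms(1,2)] lp_space_diff[OF assms(2,3)]] by simp

text \<open>At every index at most one of the two terms survives. Consequently \<open>n\<close>
  disjoint vectors of the unit ball add up to norm at most \<open>n powr (1 / s)\<close>, the growth
  rate on which the whole argument rests.\<close>

lemma lp_sum_disjoint_add:
  assumes "p \<in> lp_space" "q \<in> lp_space" "\<And>m. p m = 0 \<or> q m = 0"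
  shows "lp_sum (\<lambda>m. p m + q m) = lp_sum p + lp_sum q"
proof -
  have "lp_term (\<lambda>m. p m + q m) = (\<lambda>m. lp_term p m + lp_term q m)"
  proof
    fix m
    show "lp_term (\<lambda>m. p m + q m) m = lp_term p m + lp_term q m"
      using assms(3)[of m] by (auto simp: lp_term_def)
  qed
  then show ?thesis
    using assms by (simp add: lp_sum_def lp_space_def infsum_add)
qed

lemma cut_in_lp_space: "p \<in> lp_space \<Longrightarrow> cut A p \<in> lp_space"
  and lp_norm_cut_le: "p \<in> lp_space \<Longrightarrow> lp_norm (cut A p) \<le> lp_norm p"
  using lp_spaceI_mono(1,3)[of p "cut A p"] by simp_all

lemma lp_sum_cut:
  assumes "p \<in> lp_space"
  shows "lp_sum p = lp_sum (cut A p) + lp_sum (cut (- A) p)"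
proof -
  have "(\<lambda>m. cut A p m + cut (- A) p m) = p"
    by auto
  then show ?thesis
    using lp_sum_disjoint_add[of "cut A p" "cut (- A) p"] assms by (simp add: cut_in_lp_space)
qed

lemma finite_support_lp:
  assumes "finite F" "\<And>m. m \<notin> F \<Longrightarrow> p m = 0"
  shows "p \<in> lp_space" and "lp_sum p = sum (lp_term p) F"
proof -
  have *: "lp_term p m = 0" if "m \<notin> F" for m
    using assms(2)[OF that] by (simp add: lp_term_def)
  show "p \<in> lp_space"
    unfolding lp_space_def mem_Collect_eq
    using summable_on_cong_neutral[of UNIV F "lp_term p" "lp_term p"] * assms(1) by auto
  show "lp_sum p = sum (lp_term p) F"
    unfolding lp_sum_def
    using infsum_cong_neutral[of UNIV F "lp_term p" "lp_term p"] * assms(1) by auto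
qed

text \<open>Density of the finitely supported vectors: a partial sum within \<open>e powr s\<close>
  of the total leaves at most that much on the complement.\<close>

lemma lp_norm_cut_tail:
  assumes "p \<in> lp_space" "e > 0"
  obtains F where "finite F" "lp_norm (cut (- F) p) \<le> e"
proof -
  obtain F where F: "finite F" "dist (sum (lp_term p) F) (lp_sum p) \<le> e powr s"
    using infsum_finite_approximation[of "lp_term p" UNIV "e powr s"] assms
    by (auto simp: lp_space_def lp_sum_def)
  have "lp_sum (cut F p) = sum (lp_term p) F"
    using F(1) by (subst finite_support_lp(2)[of F]) (auto simp: lp_term_def intro!: sum.cong)
  then have "lp_sum (cut (- F) p) \<le> e powr s"
    using F(2) lp_sum_cut[OF assms(1), of F] by (simp add: dist_real_def)
  then show ?thesis
    using that F(1) assms(2) by (simp add: lp_norm_le_iff)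
qed

text \<open>A Fatou property: each finite partial sum is continuous in its coordinates, so the bound
  passes to the limit. Asking for it only from \<open>n0\<close> on allows tails of Cauchy
  sequences.\<close>

lemma lp_norm_pointwise_limit:
  assumes "\<And>n. n \<ge> n0 \<Longrightarrow> p n \<in> lp_space \<and> lp_norm (p n) \<le> e" and "e \<ge> 0"
    and "\<And>m. (\<lambda>n. p n m) \<longlonglongrightarrow> q m"
  shows "q \<in> lp_space" and "lp_norm q \<le> e"
proof -
  have le: "sum (lp_term q) F \<le> e powr s" if "finite F" for F
  proof (rule tendsto_upperbound)
    show "(\<lambda>n. sum (lp_term (p n)) F) \<longlonglongrightarrow> sum (lp_term q) F"
      unfolding lp_term_def
      using s_pos assms(3) by (intro tendsto_intros) auto
    show "\<forall>\<^sub>F n in sequentially. sum (lp_term (p n)) F \<le> e powr s"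
      unfolding eventually_sequentially
      using sum_lp_term_le[OF _ that] assms(1,2) by (meson lp_norm_le_iff order_trans)
  qed simp
  show "q \<in> lp_space" "lp_norm q \<le> e"
    using lp_spaceI[OF le] assms(2) by (auto simp: lp_norm_le_iff)
qed

section \<open>The norm metric and its completeness\<close>

lemma Metric_space_lp: "Metric_space lp_space (\<lambda>p q. lp_norm (\<lambda>m. p m - q m))"
proof
  fix p q r
  assume "p \<in> lp_space" "q \<in> lp_space"
  then show "lp_norm (\<lambda>m. p m - q m) = 0 \<longleftrightarrow> p = q"
    using lp_norm_eq_0[OF lp_space_diff, of p q] by (auto simp: fun_eq_iff)
next
  fix p q r
  assume "p \<in> lp_space" "q \<in> lp_space" "r \<in> lp_space"
  then show "lp_norm (\<lambda>m. p m - r m) \<le> lp_norm (\<lambda>m. p m - q m) + lp_norm (\<lambda>m. q m - r m)"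
    by (rule lp_norm_triangle_diff)
qed (simp, rule lp_norm_minus_commute)

sublocale lp: Metric_space lp_space "\<lambda>p q. lp_norm (\<lambda>m. p m - q m)"
  by (rule Metric_space_lp)

lemma mcomplete_lp: "lp.mcomplete"
  unfolding lp.mcomplete_def
proof (intro allI impI)
  fix \<sigma>
  assume \<sigma>: "lp.MCauchy \<sigma>"
  then have mem: "\<sigma> n \<in> lp_space" for n
    by (auto simp: lp.MCauchy_def)
  have ev: "\<exists>N. \<forall>n\<ge>N. \<forall>n'\<ge>N. lp_norm (\<lambda>m. \<sigma> n m - \<sigma> n' m) < e" if "e > 0" for e
    using \<sigma> that by (simp add: lp.MCauchy_def)
  have "Cauchy (\<lambda>n. \<sigma> n m)" for m
  proof (rule metric_CauchyI)
    fix e :: real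
    assume "e > 0"
    then obtain N where N: "\<And>n n'. n \<ge> N \<Longrightarrow> n' \<ge> N \<Longrightarrow>
        lp_norm (\<lambda>m. \<sigma> n m - \<sigma> n' m) < v m powr (1 / s) * e"
      using ev[of "v m powr (1 / s) * e"] v_pos[of m] by auto
    have "dist (\<sigma> n m) (\<sigma> n' m) < e" if "n \<ge> N" "n' \<ge> N" for n n'
    proof -
      have "v m powr (1 / s) * dist (\<sigma> n m) (\<sigma> n' m) < v m powr (1 / s) * e"
        using norm_coord_le[OF lp_space_diff[OF mem mem], of m n n'] N[OF that]
        by (simp add: dist_norm)
      then show ?thesis
        using v_pos[of m] by simp
    qed
    then show "\<exists>N. \<forall>n\<ge>N. \<forall>n'\<ge>N. dist (\<sigma> n m) (\<sigma> n' m) < e" by blast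
  qed
  then have "\<exists>q. \<forall>m. (\<lambda>n. \<sigma> n m) \<longlonglongrightarrow> q m"
    by (intro choice allI) (simp add: Cauchy_convergent_iff convergent_def)
  then obtain q where q: "\<And>m. (\<lambda>n. \<sigma> n m) \<longlonglongrightarrow> q m"
    by blast
  \<comment> \<open>Fix \<open>n\<close> and let \<open>n'\<close> tend to infinity in the Cauchy
    estimate; the Fatou property gives membership of the difference together with its norm
    bound.\<close>
  have close: "\<exists>N. \<forall>n\<ge>N. (\<lambda>m. \<sigma> n m - q m) \<in> lp_space \<and> lp_norm (\<lambda>m. \<sigma> n m - q m) \<le> e"
    if "e > 0" for e
  proof -
    obtain N where N: "\<And>n n'. n \<ge> N \<Longrightarrow> n' \<ge> N \<Longrightarrow> lp_norm (\<lambda>m. \<sigma> n m - \<sigma> n' m) < e"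
      using ev[OF \<open>e > 0\<close>] by blast
    have "(\<lambda>m. \<sigma> n m - q m) \<in> lp_space \<and> lp_norm (\<lambda>m. \<sigma> n m - q m) \<le> e" if n: "n \<ge> N" for n
    proof -
      have "(\<lambda>m. \<sigma> n m - \<sigma> n' m) \<in> lp_space \<and> lp_norm (\<lambda>m. \<sigma> n m - \<sigma> n' m) \<le> e"
        if "n' \<ge> N" for n'
        using N[OF n that] lp_space_diff[OF mem mem] by auto
      moreover have "(\<lambda>n'. \<sigma> n m - \<sigma> n' m) \<longlonglongrightarrow> \<sigma> n m - q m" for m
        by (intro tendsto_intros q)
      ultimately show ?thesis
        using lp_norm_pointwise_limit[of N "\<lambda>n' m. \<sigma> n m - \<sigma> n' m" e "\<lambda>m. \<sigma> n m - q m"]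
          \<open>e > 0\<close> by simp
    qed
    then show ?thesis by blast
  qed
  obtain n where "(\<lambda>m. \<sigma> n m - q m) \<in> lp_space"
    using close[of 1] by auto
  from lp_space_diff[OF mem[of n] this] have qm: "q \<in> lp_space" by simp
  have "limitin lp.mtopology \<sigma> q sequentially"
    unfolding lp.limitin_metric eventually_sequentially
  proof (intro conjI qm allI impI)
    fix e :: real
    assume "e > 0"
    then show "\<exists>N. \<forall>n\<ge>N. \<sigma> n \<in> lp_space \<and> lp_norm (\<lambda>m. \<sigma> n m - q m) < e"
      using close[of "e / 2"] mem by fastforce
  qed
  then show "\<exists>q. limitin lp.mtopology \<sigma> q sequentially" by blast
qed

section \<open>Control by finitely many coordinates, and growth of disjoint sums\<close>

lemma lp_norm_diff_le:
  assumes "p \<in> lp_space" "q \<in> lp_space"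
  shows "lp_norm (\<lambda>m. p m - q m) \<le> lp_norm p + lp_norm q"
  using lp_norm_triangle_diff[OF assms(1) lp_zero(1) assms(2)]
    lp_norm_minus_commute[of "\<lambda>_. 0" q] by simp

lemma lp_norm_small_on_finite:
  assumes "finite K" "e > 0"
  obtains h where "h > 0"
    "\<And>p. (\<And>m. m \<notin> K \<Longrightarrow> p m = 0) \<Longrightarrow> (\<And>m. m \<in> K \<Longrightarrow> cmod (p m) \<le> h) \<Longrightarrow> lp_norm p \<le> e"
proof
  \<comment> \<open>The summand 1 keeps \<open>c\<close> positive even for empty \<open>K\<close>,
    so that the threshold \<open>e / c powr (1 / s)\<close> is meaningful.\<close>
  define c where "c = 1 + sum v K"
  have c: "c \<ge> 1"
    using v_pos by (simp add: c_def sum_nonneg less_imp_le)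
  show "e / c powr (1 / s) > 0"
    using assms c by simp
  fix p :: "'a \<Rightarrow> complex"
  assume out: "\<And>m. m \<notin> K \<Longrightarrow> p m = 0" and le: "\<And>m. m \<in> K \<Longrightarrow> cmod (p m) \<le> e / c powr (1 / s)"
  have h: "(e / c powr (1 / s)) powr s = e powr s / c"
    using assms c s_pos by (simp add: powr_divide powr_powr)
  have "lp_sum p = sum (lp_term p) K"
    using finite_support_lp(2)[OF assms(1) out] .
  also have "\<dots> \<le> (\<Sum>m\<in>K. v m * (e powr s / c))"
    unfolding lp_term_def h[symmetric] using v_pos le s_pos
    by (intro sum_mono mult_left_mono powr_mono2) (auto intro: less_imp_le)
  also have "\<dots> = (c - 1) * (e powr s / c)"
    by (simp only: sum_distrib_right[symmetric]) (simp add: c_def)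
  also have "\<dots> \<le> c * (e powr s / c)"
    using c by (intro mult_right_mono) auto
  also have "\<dots> = e powr s"
    using c by simp
  finally show "lp_norm p \<le> e"
    using assms(2) by (simp add: lp_norm_le_iff)
qed

text \<open>On \<open>F\<close> the coordinates of vectors in \<open>B\<close> stay in one compact
  set \<open>D\<close>, which has a finite net \<open>N\<close>. The label \<open>g p\<close>
  records a net point near each \<open>p m\<close> with \<open>m\<close> in \<open>F\<close>; there
  are only finitely many such labels, and vectors with equal labels share the net points.\<close>

lemma finite_coordinate_classes:
  assumes "finite F" "h > 0" and B: "B \<subseteq> lp_space" "\<And>p. p \<in> B \<Longrightarrow> lp_norm p \<le> R"
  obtains g :: "('a \<Rightarrow> complex) \<Rightarrow> ('a \<Rightarrow> complex)" where "finite (g ` B)"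
    "\<And>p q m. p \<in> B \<Longrightarrow> q \<in> B \<Longrightarrow> g p = g q \<Longrightarrow> m \<in> F \<Longrightarrow> cmod (p m - q m) \<le> h"
proof -
  define D where "D = (\<Union>m\<in>F. cball (0 :: complex) (R / v m powr (1 / s)))"
  have "compact D"
    unfolding D_def using assms(1) by (intro compact_UN) auto
  then obtain N where N: "finite N" "D \<subseteq> (\<Union>c\<in>N. ball c (h / 2))"
    using assms(2) unfolding compact_eq_totally_bounded by (meson half_gt_zero)
  have "\<exists>c\<in>N. dist c (p m) < h / 2" if "p \<in> B" "m \<in> F" for p m
  proof -
    have "v m powr (1 / s) * cmod (p m) \<le> R"
      using norm_coord_le[of p m] B that by (meson order_trans subsetD)
    then have "p m \<in> D"
      using that(2) v_pos[of m] by (auto simp: D_def field_simps intro!: bexI[of _ m])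
    then obtain c where "c \<in> N" "p m \<in> ball c (h / 2)"
      using N(2) by blast
    then show ?thesis
      by (intro bexI[of _ c]) simp_all
  qed
  then obtain c where c: "\<And>p m. p \<in> B \<Longrightarrow> m \<in> F \<Longrightarrow> c p m \<in> N \<and> dist (c p m) (p m) < h / 2"
    by metis
  show ?thesis
  proof
    show "finite ((\<lambda>p. restrict (c p) F) ` B)"
      by (rule finite_subset[OF _ finite_PiE[OF assms(1), of "\<lambda>_. N"]]) (use c N(1) in auto)
    fix p q m
    assume "p \<in> B" "q \<in> B" "restrict (c p) F = restrict (c q) F" "m \<in> F"
    moreover from this have "c p m = c q m"
      by (metis restrict_apply')
    ultimately have "dist (c p m) (p m) < h / 2" "dist (c p m) (q m) < h / 2"
      using c[of p m] c[of q m] by simp_all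
    then have "dist (p m) (q m) < h"
      by (rule dist_triangle_half_r)
    then show "cmod (p m - q m) \<le> h"
      by (simp add: dist_norm)
  qed
qed

text \<open>
  If every finitely supported vector could be prolonged by a disjoint vector of the unit ball so as
  to increase \<open>H\<close> by \<open>d\<close>, then after \<open>n\<close> steps \<open>H\<close> would be at least \<open>n d\<close>, while the norm is at
  most \<open>n powr (1 / s)\<close>.
\<close>

lemma no_unbounded_prolongation:
  fixes H :: "('a \<Rightarrow> complex) \<Rightarrow> real"
  assumes r: "0 < r" "r < s" and d: "d > 0" and C: "C \<ge> 0"
    and H0: "H (\<lambda>_. 0) \<ge> 0"
    and bound: "\<And>x. finite {m. x m \<noteq> 0} \<Longrightarrow> H x \<le> C * lp_norm x powr r"
    and prolong: "\<And>x. finite {m. x m \<noteq> 0} \<Longrightarrow>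
      \<exists>y. finite {m. y m \<noteq> 0} \<and> (\<forall>m. x m = 0 \<or> y m = 0) \<and> lp_norm y \<le> 1 \<and>
        H (\<lambda>m. x m + y m) \<ge> H x + d"
  shows False
proof -
  have ex: "\<exists>x. finite {m. x m \<noteq> 0} \<and> lp_sum x \<le> real n \<and> H x \<ge> real n * d" for n
  proof (induction n)
    case 0
    then show ?case
      using H0 by (intro exI[of _ "\<lambda>_. 0"]) (simp add: lp_zero)
  next
    case (Suc n)
    then obtain x where x: "finite {m. x m \<noteq> 0}" "lp_sum x \<le> real n" "H x \<ge> real n * d"
      by blast
    obtain y where y: "finite {m. y m \<noteq> 0}" "\<And>m. x m = 0 \<or> y m = 0" "lp_norm y \<le> 1"
      "H (\<lambda>m. x m + y m) \<ge> H x + d"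
      using prolong[OF x(1)] by blast
    have mem: "x \<in> lp_space" "y \<in> lp_space"
      using finite_support_lp(1) x(1) y(1) by blast+
    have "finite {m. x m + y m \<noteq> 0}"
      by (rule finite_subset[OF _ finite_UnI[OF x(1) y(1)]]) auto
    moreover have "lp_sum (\<lambda>m. x m + y m) \<le> real (Suc n)"
      using lp_sum_disjoint_add[OF mem y(2)] x(2) y(3) lp_norm_le_iff[of 1 y] by simp
    moreover have "H (\<lambda>m. x m + y m) \<ge> real (Suc n) * d"
      using x(3) y(4) by (simp add: algebra_simps)
    ultimately show ?case
      by (intro exI[of _ "\<lambda>m. x m + y m"]) blast
  qed
  \<comment> \<open>The gap between the growth rates: \<open>n * d \<le> C * n powr (r / s)\<close>
    amounts to \<open>d * n powr a \<le> C\<close>. The choice of \<open>n\<close> makes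
    \<open>n powr a\<close> at least \<open>C / d + 1\<close>, contradicting this.\<close>
  define a where "a = 1 - r / s"
  have a: "a > 0" "a \<le> 1"
    using r by (auto simp: a_def)
  obtain n where n: "real n \<ge> (C / d + 1) powr (1 / a)"
    using real_arch_simple by blast
  have C1: "C / d + 1 \<ge> 1"
    using C d by simp
  have n0: "real n > 0"
    using n C1 by (smt (verit) powr_gt_zero)
  have "C / d + 1 = ((C / d + 1) powr (1 / a)) powr a"
    using a C1 by (simp add: powr_powr)
  also have "\<dots> \<le> real n powr a"
    using n a by (intro powr_mono2) auto
  finally have big: "C + d \<le> d * real n powr a"
    using d by (simp add: field_simps)
  obtain x where x: "finite {m. x m \<noteq> 0}" "lp_sum x \<le> real n" "H x \<ge> real n * d"
    using ex by blast
  have "lp_norm x \<le> real n powr (1 / s)"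
    using x(2) s_pos by (subst lp_norm_le_iff) (auto simp: powr_powr)
  then have "lp_norm x powr r \<le> real n powr (r / s)"
    using powr_mono2[of r "lp_norm x" "real n powr (1 / s)"] r by (simp add: powr_powr)
  then have "real n * d \<le> C * real n powr (r / s)"
    using bound[OF x(1)] x(3) C by (meson mult_left_mono order_trans)
  moreover have "real n = real n powr a * real n powr (r / s)"
    using n0 by (simp add: a_def powr_add[symmetric])
  ultimately have "(d * real n powr a) * real n powr (r / s) \<le> C * real n powr (r / s)"
    by (metis mult.commute mult.left_commute)
  then have "d * real n powr a \<le> C"
    using n0 by (simp add: mult_le_cancel_right)
  then show False
    using big d by simp
qed

text \<open>Otherwise every finitely supported \<open>x\<close> has, off its support, a unit-ball
  vector on which the modulus of \<open>f\<close> exceeds \<open>e\<close>. Once rotated to the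
  phase of \<open>f x\<close>, it raises the modulus by at least \<open>e\<close>, while boundedness
  gives growth exponent 1, below \<open>s\<close>.\<close>

lemma functional_small_off_finite:
  fixes f :: "('a \<Rightarrow> complex) \<Rightarrow> complex"
  assumes s: "s > 1"
    and add: "\<And>p q. p \<in> lp_space \<Longrightarrow> q \<in> lp_space \<Longrightarrow> f (\<lambda>m. p m + q m) = f p + f q"
    and scale: "\<And>c p. p \<in> lp_space \<Longrightarrow> f (\<lambda>m. c * p m) = c * f p"
    and bound: "\<And>p. p \<in> lp_space \<Longrightarrow> cmod (f p) \<le> C * lp_norm p"
    and C: "C \<ge> 0" and e: "e > 0"
  shows "\<exists>F. finite F \<and> (\<forall>y. finite {m. y m \<noteq> 0} \<and> (\<forall>m\<in>F. y m = 0) \<and> lp_norm y \<le> 1 \<longrightarrow>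
    cmod (f y) \<le> e)"
proof (rule ccontr)
  assume "\<not> ?thesis"
  then have large: "\<exists>y. finite {m. y m \<noteq> 0} \<and> (\<forall>m\<in>F. y m = 0) \<and> lp_norm y \<le> 1 \<and> cmod (f y) > e"
    if "finite F" for F
    using that by (meson not_le)
  show False
  proof (rule no_unbounded_prolongation[of 1 e C "\<lambda>x. cmod (f x)"])
    fix x :: "'a \<Rightarrow> complex"
    assume x: "finite {m. x m \<noteq> 0}"
    have mem: "x \<in> lp_space"
      using finite_support_lp(1)[OF x] by blast
    show "cmod (f x) \<le> C * lp_norm x powr 1"
      using bound[OF mem] by simp
    obtain y where y: "finite {m. y m \<noteq> 0}" "\<And>m. x m = 0 \<or> y m = 0" "lp_norm y \<le> 1" "cmod (f y) > e"
      using large[OF x] by blast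
    have memy: "y \<in> lp_space"
      using finite_support_lp(1)[OF y(1)] by blast
    \<comment> \<open>The phase \<open>c\<close> aligns the two values of \<open>f\<close>.\<close>
    define c where "c = (if f x = 0 then 1 else sgn (f x) / sgn (f y))"
    have fy: "f y \<noteq> 0"
      using y(4) e by auto
    have c: "cmod c = 1"
      using fy by (auto simp: c_def norm_divide norm_sgn)
    have "cmod (f x + c * f y) = cmod (f x) + cmod (f y)"
    proof (cases "f x = 0")
      case False
      have "f z = of_real (cmod (f z)) * sgn (f z)" for z
        by (simp add: sgn_eq)
      then have "f x + c * f y = of_real (cmod (f x) + cmod (f y)) * sgn (f x)"
        using fy False by (simp add: c_def sgn_eq field_simps)
      then show ?thesis
        using False by (simp add: norm_mult norm_sgn del: of_real_add)
    qed (simp add: c_def)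
    then have "cmod (f (\<lambda>m. x m + c * y m)) \<ge> cmod (f x) + e"
      using add[OF mem lp_space_scale[OF memy]] scale[OF memy] y(4) by simp
    moreover have "finite {m. c * y m \<noteq> 0}"
      by (rule finite_subset[OF _ y(1)]) auto
    moreover have "lp_norm (\<lambda>m. c * y m) \<le> 1"
      using y(3) c by (simp add: lp_norm_scale)
    moreover have "\<forall>m. x m = 0 \<or> c * y m = 0"
      using y(2) by auto
    ultimately show "\<exists>y. finite {m. y m \<noteq> 0} \<and> (\<forall>m. x m = 0 \<or> y m = 0) \<and> lp_norm y \<le> 1 \<and>
        cmod (f (\<lambda>m. x m + y m)) \<ge> cmod (f x) + e"
      by (intro exI[of _ "\<lambda>m. c * y m"]) blast
  qed (use s C e in auto)
qed

text \<open>If \<open>K\<close> carries \<open>z\<close> up to a small error and \<open>y\<close> is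
  small on \<open>K\<close>, then \<open>z + y\<close> is close to \<open>z\<close> on
  \<open>K\<close> and to \<open>y\<close> off \<open>K\<close>, and the powers of the norms of the
  two pieces add. \<open>K\<close> and \<open>h\<close> depend on \<open>z\<close> but not on
  \<open>y\<close>, so \<open>y\<close> can be chosen afterwards.\<close>

lemma lp_sum_add_almost_disjoint:
  assumes z: "z \<in> lp_space" and e: "0 < e" "e < d"
  obtains K h where "finite K" "h > 0"
    "\<forall>y\<in>lp_space. (\<forall>m\<in>K. cmod (y m) \<le> h) \<and> lp_norm y \<ge> d \<longrightarrow>
      lp_sum (\<lambda>m. z m + y m) \<ge> lp_sum z + e powr s"
proof -
  \<comment> \<open>At \<open>\<eta> = 0\<close> the expression is
    \<open>lp_sum z + d powr s\<close>, strictly above the target since \<open>e < d\<close>, so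
    some positive \<open>\<eta>\<close> still works. The \<open>max 0\<close> keeps the bases
    nonnegative, for instance when \<open>z\<close> is zero.\<close>
  have "((\<lambda>\<eta>. max 0 (lp_norm z - 2 * \<eta>) powr s + max 0 (d - 2 * \<eta>) powr s) \<longlongrightarrow>
      max 0 (lp_norm z - 2 * 0) powr s + max 0 (d - 2 * 0) powr s) (at_right 0)"
    using s_pos by (intro tendsto_intros) auto
  moreover have "lp_sum z + e powr s < max 0 (lp_norm z - 2 * 0) powr s + max 0 (d - 2 * 0) powr s"
    using e s_pos by (simp add: lp_norm_powr powr_less_mono2)
  ultimately have "\<forall>\<^sub>F \<eta> in at_right 0. 
      lp_sum z + e powr s < max 0 (lp_norm z - 2 * \<eta>) powr s + max 0 (d - 2 * \<eta>) powr s"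
    by (rule order_tendstoD(1))
  then have "\<forall>\<^sub>F \<eta> in at_right 0. \<eta> > 0 \<and>
      lp_sum z + e powr s < max 0 (lp_norm z - 2 * \<eta>) powr s + max 0 (d - 2 * \<eta>) powr s"
    by (intro eventually_conj eventually_at_right_less)
  then obtain \<eta> :: real where \<eta>: "\<eta> > 0"
    "lp_sum z + e powr s < max 0 (lp_norm z - 2 * \<eta>) powr s + max 0 (d - 2 * \<eta>) powr s"
    using eventually_happens'[OF trivial_limit_at_right_real] by blast
  obtain K where K: "finite K" "lp_norm (cut (- K) z) \<le> \<eta>"
    using lp_norm_cut_tail[OF z \<eta>(1)] .
  obtain h where h: "h > 0"
    "\<And>p. (\<And>m. m \<notin> K \<Longrightarrow> p m = 0) \<Longrightarrow> (\<And>m. m \<in> K \<Longrightarrow> cmod (p m) \<le> h) \<Longrightarrow> lp_norm p \<le> \<eta>"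
    using lp_norm_small_on_finite[OF K(1) \<eta>(1)] by metis
  have "lp_sum (\<lambda>m. z m + y m) \<ge> lp_sum z + e powr s"
    if y: "y \<in> lp_space" "\<And>m. m \<in> K \<Longrightarrow> cmod (y m) \<le> h" "lp_norm y \<ge> d" for y
  proof -
    define q where "q = (\<lambda>m. z m + y m)"
    have q: "q \<in> lp_space"
      unfolding q_def using z y(1) by (rule lp_space_add)
    have yK: "lp_norm (cut K y) \<le> \<eta>"
      using y(2) by (intro h(2)) auto
    \<comment> \<open>This one vector is, up to sign, the error of both approximations: of
      \<open>z\<close> by \<open>cut K q\<close> and of \<open>y\<close> by
      \<open>cut (- K) q\<close>.\<close>
    have err: "lp_norm (\<lambda>m. cut (- K) z m - cut K y m) \<le> 2 * \<eta>"
      using lp_norm_diff_le[of "cut (- K) z" "cut K y"] z y(1) K(2) yK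
      by (simp add: cut_in_lp_space)
    have "(\<lambda>m. z m - cut K q m) = (\<lambda>m. cut (- K) z m - cut K y m)"
      by (auto simp: q_def)
    then have "lp_norm z \<le> lp_norm (cut K q) + 2 * \<eta>"
      using lp_norm_triangle_sub[OF z cut_in_lp_space[OF q, of K]] err by simp
    then have 1: "max 0 (lp_norm z - 2 * \<eta>) powr s \<le> lp_sum (cut K q)"
      unfolding lp_norm_powr[symmetric] using s_pos by (intro powr_mono2) auto
    have "(\<lambda>m. y m - cut (- K) q m) = (\<lambda>m. cut K y m - cut (- K) z m)"
      by (auto simp: q_def)
    then have "lp_norm y \<le> lp_norm (cut (- K) q) + 2 * \<eta>"
      using lp_norm_triangle_sub[OF y(1) cut_in_lp_space[OF q, of "- K"]] err
        lp_norm_minus_commute[of "cut K y"] by simp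
    then have 2: "max 0 (d - 2 * \<eta>) powr s \<le> lp_sum (cut (- K) q)"
      unfolding lp_norm_powr[symmetric] using s_pos y(3) by (intro powr_mono2) auto
    show ?thesis
      using 1 2 \<eta>(2) lp_sum_cut[OF q, of K] by (simp add: q_def)
  qed
  then show ?thesis
    using that[OF K(1) h(1)] by blast
qed

end

section \<open>Bounded operators: smallness off finite sets and total boundedness\<close>

locale lp_operator = X: weighted_lp v s + Y: weighted_lp u t
  for v :: "'a \<Rightarrow> real" and s :: real and u :: "'b \<Rightarrow> real" and t :: real +
  fixes T :: "('a \<Rightarrow> complex) \<Rightarrow> 'b \<Rightarrow> complex" and C :: real
  assumes maps: "p \<in> X.lp_space \<Longrightarrow> T p \<in> Y.lp_space"
    and add: "p \<in> X.lp_space \<Longrightarrow> q \<in> X.lp_space \<Longrightarrow> T (\<lambda>m. p m + q m) = (\<lambda>m. T p m + T q m)"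
    and scale: "p \<in> X.lp_space \<Longrightarrow> T (\<lambda>m. c * p m) = (\<lambda>m. c * T p m)"
    and bound: "p \<in> X.lp_space \<Longrightarrow> Y.lp_norm (T p) \<le> C * X.lp_norm p"
    and C_pos: "C > 0"
begin

lemma diff:
  assumes "p \<in> X.lp_space" "q \<in> X.lp_space"
  shows "T (\<lambda>m. p m - q m) = (\<lambda>m. T p m - T q m)"
  using add[OF assms(1) X.lp_space_scale[OF assms(2), of "-1"]] scale[OF assms(2), of "-1"] by simp

lemma coord_bound:
  assumes "p \<in> X.lp_space"
  shows "cmod (T p m) \<le> C / u m powr (1 / t) * X.lp_norm p"
proof -
  have "u m powr (1 / t) * cmod (T p m) \<le> C * X.lp_norm p"
    using Y.norm_coord_le[OF maps[OF assms]] bound[OF assms] by (rule order_trans)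
  then show ?thesis
    using Y.v_pos[of m] by (simp add: field_simps)
qed

lemma small_off_finite_aux:
  assumes "t < s" "e > 0"
  shows "\<exists>F. finite F \<and> (\<forall>y. finite {m. y m \<noteq> 0} \<and> (\<forall>m\<in>F. y m = 0) \<and> X.lp_norm y \<le> 1 \<longrightarrow>
    Y.lp_norm (T y) \<le> e)"
proof (rule ccontr)
  assume "\<not> ?thesis"
  then have large: "\<exists>y. finite {m. y m \<noteq> 0} \<and> (\<forall>m\<in>F. y m = 0) \<and> X.lp_norm y \<le> 1 \<and>
      Y.lp_norm (T y) > e" if "finite F" for F
    using that by (meson not_le)
  show False
  \<comment> \<open>The growing quantity is the t-th power of the norm of \<open>T x\<close>. It is
    bounded by a multiple of \<open>X.lp_norm x powr t\<close>, and \<open>t < s\<close> supplies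
    the gap. Halving \<open>e\<close> leaves room for the images being only almost disjoint.\<close>
  proof (rule X.no_unbounded_prolongation[of t "(e / 2) powr t" "C powr t" "\<lambda>x. Y.lp_sum (T x)"])
    fix x :: "'a \<Rightarrow> complex"
    assume x: "finite {m. x m \<noteq> 0}"
    have mem: "x \<in> X.lp_space"
      using X.finite_support_lp(1)[OF x] by blast
    have "Y.lp_sum (T x) \<le> (C * X.lp_norm x) powr t"
      using bound[OF mem] C_pos by (subst Y.lp_norm_le_iff[symmetric]) auto
    then show "Y.lp_sum (T x) \<le> C powr t * X.lp_norm x powr t"
      using C_pos by (simp add: powr_mult)
    have e2: "0 < e / 2" "e / 2 < e"
      using assms(2) by auto
    obtain K h where K: "finite K" and h: "h > 0" and
      increase: "\<forall>y\<in>Y.lp_space. (\<forall>m\<in>K. cmod (y m) \<le> h) \<and> Y.lp_norm y \<ge> e \<longrightarrow>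
        Y.lp_sum (\<lambda>m. T x m + y m) \<ge> Y.lp_sum (T x) + (e / 2) powr t"
      using Y.lp_sum_add_almost_disjoint[OF maps[OF mem] e2] by blast
    have "\<exists>F. finite F \<and> (\<forall>y. finite {m. y m \<noteq> 0} \<and> (\<forall>m\<in>F. y m = 0) \<and> X.lp_norm y \<le> 1 \<longrightarrow>
        cmod (T y i) \<le> h)" for i
    proof (rule X.functional_small_off_finite[of "\<lambda>p. T p i" "C / u i powr (1 / t)" h])
      show "s > 1"
        using assms(1) Y.s_ge_1 by simp
      show "C / u i powr (1 / t) \<ge> 0"
        using C_pos by simp
    qed (use add scale coord_bound h in auto)
    then obtain F where F: "\<And>i. finite (F i)"
      "\<And>i y. finite {m. y m \<noteq> 0} \<Longrightarrow> (\<forall>m\<in>F i. y m = 0) \<Longrightarrow> X.lp_norm y \<le> 1 \<Longrightarrow> cmod (T y i) \<le> h"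
      by metis
    \<comment> \<open>Vanishing on the support of \<open>x\<close> makes \<open>y\<close> disjoint
      from \<open>x\<close>; vanishing on \<open>F i\<close> for the finitely many \<open>i\<close>
      in \<open>K\<close> makes \<open>T y\<close> at most \<open>h\<close> on
      \<open>K\<close>.\<close>
    have "finite ({m. x m \<noteq> 0} \<union> (\<Union>i\<in>K. F i))"
      using x K F(1) by blast
    from large[OF this] obtain y where y: "finite {m. y m \<noteq> 0}" "X.lp_norm y \<le> 1" "Y.lp_norm (T y) > e"
      "\<forall>m\<in>{m. x m \<noteq> 0} \<union> (\<Union>i\<in>K. F i). y m = 0"
      by blast
    have memy: "y \<in> X.lp_space"
      using X.finite_support_lp(1)[OF y(1)] by blast
    have "cmod (T y i) \<le> h" if "i \<in> K" for i
      using y(4) that by (intro F(2) y(1,2)) blast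
    then have "Y.lp_sum (T (\<lambda>m. x m + y m)) \<ge> Y.lp_sum (T x) + (e / 2) powr t"
      using increase maps[OF memy] y(3) add[OF mem memy] by simp
    then show "\<exists>y. finite {m. y m \<noteq> 0} \<and> (\<forall>m. x m = 0 \<or> y m = 0) \<and> X.lp_norm y \<le> 1 \<and>
        Y.lp_sum (T (\<lambda>m. x m + y m)) \<ge> Y.lp_sum (T x) + (e / 2) powr t"
      using y by blast
  qed (use Y.s_pos Y.lp_sum_nonneg assms in auto)
qed

text \<open>Homogeneity removes the restriction to the unit ball, and density the restriction to
  finite support. Truncating \<open>y\<close> keeps it zero on \<open>F\<close>, and the discarded
  tail is controlled by the bound \<open>C\<close>.\<close>

lemma small_off_finite:
  assumes "t < s" "e > 0"
  obtains F where "finite F"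
    "\<And>y. y \<in> X.lp_space \<Longrightarrow> (\<And>m. m \<in> F \<Longrightarrow> y m = 0) \<Longrightarrow> Y.lp_norm (T y) \<le> e * X.lp_norm y"
proof -
  obtain F where F: "finite F"
    "\<And>y. finite {m. y m \<noteq> 0} \<Longrightarrow> (\<forall>m\<in>F. y m = 0) \<Longrightarrow> X.lp_norm y \<le> 1 \<Longrightarrow> Y.lp_norm (T y) \<le> e"
    using small_off_finite_aux[OF assms] by blast
  have fin: "Y.lp_norm (T y) \<le> e * X.lp_norm y"
    if y: "finite {m. y m \<noteq> 0}" "\<forall>m\<in>F. y m = 0" for y
  proof (cases "X.lp_norm y = 0")
    case True
    then show ?thesis
      using bound[of y] X.finite_support_lp(1)[OF y(1)] by fastforce
  next
    case False
    define c where "c = complex_of_real (1 / X.lp_norm y)"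
    have mem: "y \<in> X.lp_space"
      using X.finite_support_lp(1)[OF y(1)] by blast
    have c: "cmod c = 1 / X.lp_norm y"
      by (simp add: c_def norm_divide)
    have "Y.lp_norm (T (\<lambda>m. c * y m)) \<le> e"
    proof (rule F(2))
      show "finite {m. c * y m \<noteq> 0}"
        by (rule finite_subset[OF _ y(1)]) auto
    qed (use y(2) c False in \<open>auto simp: X.lp_norm_scale\<close>)
    then show ?thesis
      using False X.lp_norm_nonneg[of y] c
      by (simp add: scale[OF mem] Y.lp_norm_scale pos_divide_le_eq order.strict_iff_order)
  qed
  have "Y.lp_norm (T y) \<le> e * X.lp_norm y"
    if y: "y \<in> X.lp_space" "\<And>m. m \<in> F \<Longrightarrow> y m = 0" for y
  proof (rule field_le_epsilon)
    fix \<delta> :: real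
    assume "\<delta> > 0"
    then obtain M where M: "finite M" "X.lp_norm (cut (- M) y) \<le> \<delta> / C"
      using X.lp_norm_cut_tail[OF y(1), of "\<delta> / C"] C_pos by auto
    note mem = X.cut_in_lp_space[OF y(1)]
    have "Y.lp_norm (T (cut M y)) \<le> e * X.lp_norm (cut M y)"
      using y(2) by (intro fin finite_subset[OF _ M(1)]) auto
    also have "\<dots> \<le> e * X.lp_norm y"
      using assms(2) X.lp_norm_cut_le[OF y(1)] by (intro mult_left_mono) auto
    finally have 1: "Y.lp_norm (T (cut M y)) \<le> e * X.lp_norm y" .
    have "Y.lp_norm (T (cut (- M) y)) \<le> C * (\<delta> / C)"
      using bound[OF mem] M(2) C_pos by (meson mult_left_mono order_trans less_imp_le)
    then have 2: "Y.lp_norm (T (cut (- M) y)) \<le> \<delta>"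
      using C_pos by simp
    have "y = (\<lambda>m. cut M y m + cut (- M) y m)"
      by auto
    then have "T y = (\<lambda>m. T (cut M y) m + T (cut (- M) y) m)"
      using add[OF mem mem] by metis
    then show "Y.lp_norm (T y) \<le> e * X.lp_norm y + \<delta>"
      using Y.lp_norm_triangle[OF maps[OF mem] maps[OF mem], of M "- M"] 1 2 by simp
  qed
  then show ?thesis
    using that F(1) by blast
qed

text \<open>Two vectors of \<open>B\<close> with the same label have a difference that is small on
  \<open>F\<close>, while \<open>T\<close> shrinks its part off \<open>F\<close> by the factor
  \<open>d\<close>. Their images are therefore close, and one representative per label gives a
  finite net.\<close>

lemma mtotally_bounded_image:
  assumes "t < s" and B: "B \<subseteq> X.lp_space" "\<And>p. p \<in> B \<Longrightarrow> X.lp_norm p \<le> R"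
  shows "Y.lp.mtotally_bounded (T ` B)"
  unfolding Y.lp.mtotally_bounded_def
proof (intro allI impI)
  fix e :: real
  assume "e > 0"
  \<comment> \<open>The two parts contribute \<open>d\<close> and
    \<open>d * (2 * \<bar>R\<bar>)\<close>; the extra 1 in the denominator makes their sum strictly
    less than \<open>e\<close>. The absolute value covers a negative \<open>R\<close>, possible when
    \<open>B\<close> is empty.\<close>
  define d where "d = e / (2 * \<bar>R\<bar> + 2)"
  have d: "d > 0" "d * (2 * \<bar>R\<bar> + 1) < e"
    using \<open>e > 0\<close> by (auto simp: d_def field_simps)
  obtain F where F: "finite F"
    "\<And>y. y \<in> X.lp_space \<Longrightarrow> (\<And>m. m \<in> F \<Longrightarrow> y m = 0) \<Longrightarrow> Y.lp_norm (T y) \<le> d * X.lp_norm y"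
    using small_off_finite[OF assms(1) d(1)] by metis
  have "d / C > 0"
    using d C_pos by simp
  then obtain h where h: "h > 0"
    "\<And>p. (\<And>m. m \<notin> F \<Longrightarrow> p m = 0) \<Longrightarrow> (\<And>m. m \<in> F \<Longrightarrow> cmod (p m) \<le> h) \<Longrightarrow> X.lp_norm p \<le> d / C"
    using X.lp_norm_small_on_finite[OF F(1)] by metis
  obtain g :: "('a \<Rightarrow> complex) \<Rightarrow> ('a \<Rightarrow> complex)" where g: "finite (g ` B)"
    "\<And>p q m. p \<in> B \<Longrightarrow> q \<in> B \<Longrightarrow> g p = g q \<Longrightarrow> m \<in> F \<Longrightarrow> cmod (p m - q m) \<le> h"
    using X.finite_coordinate_classes[OF F(1) h(1) B] by metis
  have close: "Y.lp_norm (\<lambda>m. T p m - T q m) < e" if pq: "p \<in> B" "q \<in> B" "g p = g q" for p q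
  proof -
    define x where "x = (\<lambda>m. p m - q m)"
    have p: "p \<in> X.lp_space" and q: "q \<in> X.lp_space"
      using pq B(1) by auto
    have x: "x \<in> X.lp_space"
      unfolding x_def using p q by (rule X.lp_space_diff)
    note mem = X.cut_in_lp_space[OF x]
    have "X.lp_norm x \<le> 2 * \<bar>R\<bar>"
      unfolding x_def using X.lp_norm_diff_le[OF p q] B(2)[OF pq(1)] B(2)[OF pq(2)] by simp
    then have "X.lp_norm (cut (- F) x) \<le> 2 * \<bar>R\<bar>"
      using X.lp_norm_cut_le[OF x] by (rule order_trans[rotated])
    then have "d * X.lp_norm (cut (- F) x) \<le> d * (2 * \<bar>R\<bar>)"
      using d(1) by simp
    then have 1: "Y.lp_norm (T (cut (- F) x)) \<le> d * (2 * \<bar>R\<bar>)"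
      using F(2)[OF mem, of "- F"] by simp
    have "X.lp_norm (cut F x) \<le> d / C"
      using g(2)[OF pq] by (intro h(2)) (auto simp: x_def)
    then have "C * X.lp_norm (cut F x) \<le> d"
      using C_pos by (simp add: pos_le_divide_eq mult.commute)
    then have 2: "Y.lp_norm (T (cut F x)) \<le> d"
      using bound[OF mem, of F] by simp
    have "x = (\<lambda>m. cut F x m + cut (- F) x m)"
      by auto
    then have "T x = (\<lambda>m. T (cut F x) m + T (cut (- F) x) m)"
      using add[OF mem mem, of F "- F"] by simp
    then have "Y.lp_norm (T x) \<le> d + d * (2 * \<bar>R\<bar>)"
      using Y.lp_norm_triangle[OF maps[OF mem] maps[OF mem], of F "- F"] 1 2 by simp
    also have "\<dots> < e"
      using d(2) by (simp add: algebra_simps)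
    finally show ?thesis
      using diff[OF p q] by (simp add: x_def)
  qed
  \<comment> \<open>The centres must lie in the image itself, so each label is represented by an
    element of \<open>B\<close>.\<close>
  define K where "K = (\<lambda>c. T (inv_into B g c)) ` g ` B"
  show "\<exists>K. finite K \<and> K \<subseteq> T ` B \<and> T ` B \<subseteq> (\<Union>x\<in>K. Y.lp.mball x e)"
  proof (intro exI[of _ K] conjI subsetI)
    show "finite K"
      using g(1) by (simp add: K_def)
    show "y \<in> T ` B" if "y \<in> K" for y
      using that by (auto simp: K_def intro!: imageI inv_into_into)
    fix y
    assume "y \<in> T ` B"
    then obtain p where p: "p \<in> B" "y = T p"
      by blast
    define q where "q = inv_into B g (g p)"
    have q: "q \<in> B" "g q = g p"
      using p(1) by (auto simp: q_def inv_into_into f_inv_into_f)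
    have "T p \<in> Y.lp_space" "T q \<in> Y.lp_space"
      using p(1) q(1) B(1) maps by auto
    then have "y \<in> Y.lp.mball (T q) e"
      using close[OF q(1) p(1) q(2)] p(2) by simp
    moreover have "T q \<in> K"
      using p(1) by (auto simp: K_def q_def)
    ultimately show "y \<in> (\<Union>x\<in>K. Y.lp.mball x e)"
      by blast
  qed
qed

theorem compactin_closure_image:
  assumes "t < s" and B: "B \<subseteq> X.lp_space" "\<And>p. p \<in> B \<Longrightarrow> X.lp_norm p \<le> R"
  shows "compactin Y.lp.mtopology (Y.lp.mtopology closure_of (T ` B))"
  using mtotally_bounded_image[OF assms] Y.mcomplete_lp Y.lp.mtotally_bounded_eq_compact_closure_of
  by blast

end

section \<open>Specialisation to the given weighted spaces\<close>

theorem theorem3: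
  fixes k s t :: real
    and w :: "int \<Rightarrow> real"
    and T :: "(int \<Rightarrow> complex) \<Rightarrow> (int \<Rightarrow> complex)"
  assumes "\<And>m. w m > 0"
    and "s > t" and "t \<ge> 1"
    and "bounded_linear_operator (wseq_space k s w) (wseq_norm k s w)
           (wseq_space k t w) (wseq_norm k t w) T"
  shows "compact_operator (wseq_space k s w) (wseq_norm k s w)
           (wseq_space k t w) (wseq_norm k t w) T"
proof -
  \<comment> \<open>The summability exponent also enters the weight, so domain and target carry the
    different weights \<open>v s\<close> and \<open>v t\<close>.\<close>
  define v where "v = (\<lambda>r (m :: int). w m * (1 + \<bar>real_of_int m\<bar> powr r) powr k)"
  have v_pos: "v r m > 0" for r m
  proof -
    have "1 + \<bar>real_of_int m\<bar> powr r > 0"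
      by (intro add_pos_nonneg) auto
    then show ?thesis
      using assms(1)[of m] by (simp add: v_def)
  qed
  interpret X: weighted_lp "v s" s
    by standard (use v_pos assms in auto)
  interpret Y: weighted_lp "v t" t
    by standard (use v_pos assms in auto)
  have summand: "wseq_term k s w = X.lp_term" "wseq_term k t w = Y.lp_term"
    by (simp_all add: fun_eq_iff wseq_term_def X.lp_term_def Y.lp_term_def) (simp_all add: v_def)
  have space: "wseq_space k s w = X.lp_space" "wseq_space k t w = Y.lp_space"
    by (simp_all add: wseq_space_def X.lp_space_def Y.lp_space_def summand)
  have norm: "wseq_norm k s w = X.lp_norm" "wseq_norm k t w = Y.lp_norm"
    by (simp_all add: fun_eq_iff wseq_norm_def X.lp_norm_def Y.lp_norm_def X.lp_sum_def Y.lp_sum_def summand)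
  have lin: "linear_operator X.lp_space Y.lp_space T"
    using assms(4) by (simp add: bounded_linear_operator_def space)
  obtain C where C: "\<And>p. p \<in> X.lp_space \<Longrightarrow> Y.lp_norm (T p) \<le> C * X.lp_norm p"
    using assms(4) by (auto simp: bounded_linear_operator_def space norm)
  \<comment> \<open>The given constant may be zero or negative; replacing it by
    \<open>max C 1\<close> keeps the estimate, as norms are nonnegative, and makes division by it
    legitimate.\<close>
  interpret lp_operator "v s" s "v t" t T "max C 1"
  proof
    fix p q c
    assume p: "p \<in> X.lp_space"
    show "T p \<in> Y.lp_space" and "T (\<lambda>m. c * p m) = (\<lambda>m. c * T p m)"
      using lin p by (auto simp: linear_operator_def)
    show "T (\<lambda>m. p m + q m) = (\<lambda>m. T p m + T q m)" if "q \<in> X.lp_space"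
      using lin p that by (auto simp: linear_operator_def)
    have "C * X.lp_norm p \<le> max C 1 * X.lp_norm p"
      by (intro mult_right_mono) auto
    then show "Y.lp_norm (T p) \<le> max C 1 * X.lp_norm p"
      using C[OF p] by (rule order_trans[rotated])
  qed auto
  show ?thesis
    unfolding compact_operator_def norm_topology_def space norm
    using lin compactin_closure_image[OF assms(2)] by blast
qed

end
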